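(* The optimal pebbling number of the $n$-dimensional hypercube $Q_n$ satisfies \[ o(Q_n)=\Theta\!\left(\left(\tfrac43\right)^n\right)\qquad (n\to\infty). \]
   Context: $Q_n$ is the $n$-dimensional hypercube graph: its vertices are the $0/1$ strings of length $n$, two being adjacent when they differ in exactly one coordinate. A pebbling distribution $D$ on a graph $G$ assigns a nonnegative integer number $D(v)$ of pebbles to each vertex $v$; its size is $|D|=\sum_v D(v)$. A pebbling move removes two pebbles from one vertex and places one pebble on an adjacent vertex. A distribution is solvable if, for every target vertex, some (possibly empty) sequence of pebbling moves starting from $D$ places at least one pebble on the target. The optimal pebbling number $o(G)$ is the minimum size of a solvable distribution on $G$. *)

theory Defs
  imports
    Complex_Main
    "HOL-Library.Landau_Symbols"
    "Graph_Theory.Pair_Digraph"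
begin

text \<open>
  An undirected graph is encoded as a symmetric digraph: the edge between \<open>u\<close> and \<open>v\<close> is the
  pair of arcs \<open>(u, v)\<close> and \<open>(v, u)\<close>. For hypercubes, \<open>True\<close> and \<open>False\<close> play the roles
  of the bits 1 and 0.
\<close>

definition hypercube :: "nat \<Rightarrow> bool list pair_pre_digraph" where
  "hypercube n = \<lparr>
     pverts = {xs. length xs = n},
     parcs = {(xs, ys). length xs = n \<and> length ys = n \<and> card {i. i < n \<and> xs ! i \<noteq> ys ! i} = 1} \<rparr>"

lemma pverts_hypercube [simp]: "pverts (hypercube n) = {xs. length xs = n}"
  by (simp add: hypercube_def)

lemma finite_pverts_hypercube: "finite (pverts (hypercube n))"
  using finite_lists_length_eq[of "UNIV :: bool set" n] by simp

lemma pair_graph_hypercube: "pair_graph (hypercube n)"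
proof
  have "parcs (hypercube n) \<subseteq> pverts (hypercube n) \<times> pverts (hypercube n)"
    by (auto simp: hypercube_def)
  then show "finite (parcs (hypercube n))"
    by (rule finite_subset) (intro finite_cartesian_product finite_pverts_hypercube)
  show "finite (pverts (hypercube n))"
    by (rule finite_pverts_hypercube)
  show "symmetric (with_proj (hypercube n))"
    unfolding symmetric_def with_proj_simps
  proof (rule symI)
    fix xs ys assume "(xs, ys) \<in> parcs (hypercube n)"
    moreover have "{i. i < n \<and> ys ! i \<noteq> xs ! i} = {i. i < n \<and> xs ! i \<noteq> ys ! i}"
      by (intro Collect_cong) blast
    ultimately show "(ys, xs) \<in> parcs (hypercube n)"
      by (simp only: hypercube_def pair_pre_digraph.simps mem_Collect_eq prod.case)
  qed
  fix e assume e: "e \<in> parcs (hypercube n)"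
  obtain xs ys where [simp]: "e = (xs, ys)"
    by (cases e)
  from e show "fst e \<in> pverts (hypercube n)" "snd e \<in> pverts (hypercube n)"
    by (simp_all add: hypercube_def)
  from e have "card {i. i < n \<and> xs ! i \<noteq> ys ! i} = 1"
    by (simp add: hypercube_def)
  then show "fst e \<noteq> snd e"
    by (intro notI) simp
qed

text \<open>
  A pebbling distribution on \<open>G\<close> is a function \<open>D :: 'a \<Rightarrow> nat\<close>. Only its values on
  \<open>pverts G\<close> matter: the size ignores all other values, and in a well-formed graph no move
  reads or changes them.
\<close>

definition pebbling_size :: "'a pair_pre_digraph \<Rightarrow> ('a \<Rightarrow> nat) \<Rightarrow> nat" where
  "pebbling_size G D = (\<Sum>v\<in>pverts G. D v)"

definition pebbling_move :: "'a pair_pre_digraph \<Rightarrow> ('a \<Rightarrow> nat) \<Rightarrow> ('a \<Rightarrow> nat) \<Rightarrow> bool" where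
  "pebbling_move G D D' \<longleftrightarrow>
     (\<exists>u v. (u, v) \<in> parcs G \<and> 2 \<le> D u \<and> D' = D(u := D u - 2, v := D v + 1))"

definition pebbling_solvable :: "'a pair_pre_digraph \<Rightarrow> ('a \<Rightarrow> nat) \<Rightarrow> bool" where
  "pebbling_solvable G D \<longleftrightarrow>
     (\<forall>t\<in>pverts G. \<exists>D'. (pebbling_move G)\<^sup>*\<^sup>* D D' \<and> 1 \<le> D' t)"

definition optimal_pebbling_number :: "'a pair_pre_digraph \<Rightarrow> nat" where
  "optimal_pebbling_number G = (LEAST k. \<exists>D. pebbling_solvable G D \<and> pebbling_size G D = k)"

text \<open>A solvable distribution always exists, so the \<open>LEAST\<close> above is an attained minimum.\<close>

lemma pebbling_solvable_one: "pebbling_solvable G (\<lambda>_. 1)"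
  unfolding pebbling_solvable_def by (meson order_refl rtranclp.rtrancl_refl)

lemma optimal_pebbling_number_attained:
  "\<exists>D. pebbling_solvable G D \<and> pebbling_size G D = optimal_pebbling_number G"
  unfolding optimal_pebbling_number_def
  by (rule LeastI_ex) (use pebbling_solvable_one in blast)

lemma optimal_pebbling_number_le:
  "pebbling_solvable G D \<Longrightarrow> optimal_pebbling_number G \<le> pebbling_size G D"
  unfolding optimal_pebbling_number_def by (rule Least_le) blast

end

theory Submission
  imports Defs
begin

text \<open>
  Lower bound: \<open>\<Sum>\<^sub>v D(v) / 2^d(v,t)\<close> never increases under moves, so it is at least 1 for every target
  \<open>t\<close>; summing over \<open>t\<close> gives \<open>|D| (3/2)^n \<ge> 2^n\<close>.

  Upper bound: let \<open>L\<^sub>c(n)\<close> be the minimal size of a distribution that brings \<open>K\<^sub>c = 2^(4c^3)\<close>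
  pebbles to any target, divided by \<open>K\<^sub>c (4/3)^n\<close>. Split \<open>Q\<^sub>n = Q\<^sub>a \<times> Q\<^sub>b\<close> with \<open>a = min n (c^4)\<close>. In
  \<open>Q\<^sub>a\<close>, piles of \<open>2^j\<close> pebbles with \<open>j = a/3 + c^3\<close> are placed at nearly uniform positions. Nearly
  all of the weight that a pile sends out sits at distances within \<open>c^3\<close> of \<open>a/3\<close>, by Chebyshev's
  inequality. At these distances a pile brings between 1 and \<open>2^(2c^3)\<close> pebbles to the target, and
  as this is much less than \<open>K\<^sub>c\<close>, a greedy choice of positions serves all targets at once while
  losing only a factor \<open>1 + 5/c^2\<close>. Then each pile is replaced by a distribution on a
  copy of \<open>Q\<^sub>b\<close> that brings \<open>2^j\<close> pebbles to any target of that copy. If \<open>b > 0\<close>, then \<open>2^j \<ge> K\<^sub>c\<^sub>+\<^sub>1\<close>, so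
  \<open>L\<^sub>c(n) \<le> (1 + 5/c^2) L\<^sub>c\<^sub>+\<^sub>1(b)\<close>, and the product of these factors converges.
\<close>

section \<open>Reachable amounts of pebbles\<close>

text \<open>Solvability is the case \<open>k = 1\<close> at every vertex. Larger \<open>k\<close> is
  needed because whole piles get replaced by distributions that deliver equally many
  pebbles.\<close>

definition reach :: "'a pair_pre_digraph \<Rightarrow> ('a \<Rightarrow> nat) \<Rightarrow> nat \<Rightarrow> 'a \<Rightarrow> bool" where
  "reach G D k t \<longleftrightarrow> (\<exists>D'. (pebbling_move G)\<^sup>*\<^sup>* D D' \<and> k \<le> D' t)"

lemma pebbling_move_add:
  assumes "pebbling_move G D D'"
  shows "pebbling_move G (\<lambda>v. D v + E v) (\<lambda>v. D' v + E v)"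
proof -
  obtain u v where uv: "(u, v) \<in> parcs G" "2 \<le> D u" "D' = D(u := D u - 2, v := D v + 1)"
    using assms unfolding pebbling_move_def by blast
  have "(\<lambda>x. D' x + E x) = (\<lambda>x. D x + E x)(u := D u + E u - 2, v := D v + E v + 1)"
    using uv by (auto simp: fun_eq_iff)
  with uv show ?thesis
    unfolding pebbling_move_def by (intro exI[of _ u] exI[of _ v]) auto
qed

lemma pebbling_moves_add:
  "(pebbling_move G)\<^sup>*\<^sup>* D D' \<Longrightarrow> (pebbling_move G)\<^sup>*\<^sup>* (\<lambda>v. D v + E v) (\<lambda>v. D' v + E v)"
  by (induction rule: rtranclp_induct)
    (auto intro: rtranclp.rtrancl_into_rtrancl pebbling_move_add)

lemma reach_0 [simp]: "reach G D 0 t"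
  unfolding reach_def by blast

lemma reach_self: "k \<le> D t \<Longrightarrow> reach G D k t"
  unfolding reach_def by blast

lemma reach_mono: "reach G D k t \<Longrightarrow> l \<le> k \<Longrightarrow> reach G D l t"
  unfolding reach_def by (meson le_trans)

text \<open>Moves available from \<open>D\<close> stay available with \<open>E\<close> lying on top,
  so the two move sequences can be run one after the other.\<close>

lemma reach_add:
  assumes "reach G D k t" "reach G E l t"
  shows "reach G (\<lambda>v. D v + E v) (k + l) t"
proof -
  obtain D' where D': "(pebbling_move G)\<^sup>*\<^sup>* D D'" "k \<le> D' t"
    using assms(1) unfolding reach_def by blast
  obtain E' where E': "(pebbling_move G)\<^sup>*\<^sup>* E E'" "l \<le> E' t"
    using assms(2) unfolding reach_def by blast
  have "(pebbling_move G)\<^sup>*\<^sup>* (\<lambda>v. D v + E v) (\<lambda>v. D' v + E v)"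
    by (rule pebbling_moves_add[OF D'(1)])
  also have "(pebbling_move G)\<^sup>*\<^sup>* (\<lambda>v. D' v + E v) (\<lambda>v. D' v + E' v)"
    using pebbling_moves_add[OF E'(1), of D'] by (simp add: add.commute)
  finally show ?thesis
    unfolding reach_def using D'(2) E'(2) by (meson add_mono)
qed

lemma reach_sum_list:
  assumes "\<And>x. x \<in> set xs \<Longrightarrow> reach G (D x) (k x) t"
  shows "reach G (\<lambda>v. \<Sum>x\<leftarrow>xs. D x v) (\<Sum>x\<leftarrow>xs. k x) t"
  using assms by (induction xs) (auto intro: reach_add)

lemma reach_step:
  assumes "reach G D (2 * k) u" "(u, v) \<in> parcs G" "u \<noteq> v"
  shows "reach G D k v"
proof -
  \<comment> \<open>Generalised over the start and keeping the pebbles already on \<open>v\<close>,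
    so that the \<open>k\<close> moves from \<open>u\<close> to \<open>v\<close> can be made by
    induction.\<close>
  have *: "\<exists>D''. (pebbling_move G)\<^sup>*\<^sup>* D' D'' \<and> k + D' v \<le> D'' v" if "2 * k \<le> D' u" for D'
    using that
  proof (induction k arbitrary: D')
    case 0
    then show ?case by auto
  next
    case (Suc k)
    define D1 where "D1 = D'(u := D' u - 2, v := D' v + 1)"
    have "pebbling_move G D' D1"
      unfolding pebbling_move_def D1_def using assms(2) Suc.prems
      by (intro exI[of _ u] exI[of _ v]) simp
    moreover have "2 * k \<le> D1 u"
      using Suc.prems assms(3) by (simp add: D1_def)
    then obtain D'' where "(pebbling_move G)\<^sup>*\<^sup>* D1 D''" "k + D1 v \<le> D'' v"
      using Suc.IH by blast
    ultimately show ?case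
      by (intro exI[of _ D'']) (auto simp: D1_def intro: converse_rtranclp_into_rtranclp)
  qed
  obtain D' where D': "(pebbling_move G)\<^sup>*\<^sup>* D D'" "2 * k \<le> D' u"
    using assms(1) unfolding reach_def by blast
  with * obtain D'' where "(pebbling_move G)\<^sup>*\<^sup>* D' D''" "k + D' v \<le> D'' v"
    by blast
  with D'(1) show ?thesis
    unfolding reach_def by (intro exI[of _ D'']) auto
qed

section \<open>Hamming distance\<close>

text \<open>Recursive, so that sums over the cube can be evaluated one coordinate at a time;
  \<open>parcs_hypercube_iff\<close> links it to adjacency.\<close>

fun hamming :: "'a list \<Rightarrow> 'a list \<Rightarrow> nat" where
  "hamming (x # xs) (y # ys) = (if x = y then 0 else 1) + hamming xs ys"
| "hamming _ _ = 0"

lemma hamming_self [simp]: "hamming xs xs = 0"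
  by (induction xs) auto

lemma hamming_commute: "hamming xs ys = hamming ys xs"
  by (induction xs ys rule: hamming.induct) auto

lemma hamming_append_left [simp]: "hamming (xs @ ys) (xs @ zs) = hamming ys zs"
  by (induction xs) auto

lemma hamming_triangle:
  "length xs = length ys \<Longrightarrow> length ys = length zs \<Longrightarrow>
    hamming xs zs \<le> hamming xs ys + hamming ys zs"
  by (induction xs ys zs rule: list_induct3) auto

lemma card_diff_positions:
  "length xs = length ys \<Longrightarrow> card {i. i < length xs \<and> xs ! i \<noteq> ys ! i} = hamming xs ys"
proof (induction xs ys rule: list_induct2)
  case Nil
  then show ?case by simp
next
  case (Cons x xs y ys)
  let ?A = "{i. i < length xs \<and> xs ! i \<noteq> ys ! i}"
  have "{i. i < length (x # xs) \<and> (x # xs) ! i \<noteq> (y # ys) ! i}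
      = (if x = y then {} else {0}) \<union> Suc ` ?A"
  proof (rule set_eqI)
    fix i
    show "i \<in> {i. i < length (x # xs) \<and> (x # xs) ! i \<noteq> (y # ys) ! i}
        \<longleftrightarrow> i \<in> (if x = y then {} else {0}) \<union> Suc ` ?A"
      by (cases i) auto
  qed
  then show ?case
    using Cons.IH by (auto simp: card_image card_insert_if)
qed

lemma parcs_hypercube_iff:
  "(xs, ys) \<in> parcs (hypercube n) \<longleftrightarrow> length xs = n \<and> length ys = n \<and> hamming xs ys = 1"
  using card_diff_positions[of xs ys] by (auto simp: hypercube_def)

text \<open>Coordinates are corrected from left to right, each wrong one halving the pebbles.
  \<open>ps\<close> collects the corrected ones; \<open>ss\<close> is the untouched coordinate block
  of the other factor of a product.\<close>

lemma reach_hamming: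
  assumes "length xs = length ts" "n = length ps + length xs + length ss"
    and "reach (hypercube n) D (2 ^ hamming xs ts * k) (ps @ xs @ ss)"
  shows "reach (hypercube n) D k (ps @ ts @ ss)"
  using assms
proof (induction xs ts arbitrary: ps rule: list_induct2)
  case Nil
  then show ?case by simp
next
  case (Cons x xs t ts)
  have "reach (hypercube n) D (2 ^ hamming xs ts * k) ((ps @ [t]) @ xs @ ss)"
  proof (cases "x = t")
    case True
    with Cons.prems show ?thesis by simp
  next
    case False
    have "reach (hypercube n) D (2 * (2 ^ hamming xs ts * k)) (ps @ (x # xs) @ ss)"
      using Cons.prems False by (simp add: mult_ac)
    then show ?thesis
      by (rule reach_step) (use Cons.prems False in \<open>auto simp: parcs_hypercube_iff\<close>)
  qed
  then have "reach (hypercube n) D k ((ps @ [t]) @ ts @ ss)"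
    by (rule Cons.IH[rotated]) (use Cons.prems in auto)
  then show ?case by simp
qed

section \<open>Moments of the weight \<open>2^(- hamming)\<close>\<close>

lemma sum_length_Suc:
  "(\<Sum>xs | length xs = Suc n. f xs) = (\<Sum>xs | length xs = n. f (True # xs) + f (False # xs))"
  for f :: "bool list \<Rightarrow> 'b::comm_monoid_add"
proof -
  let ?A = "{xs :: bool list. length xs = n}"
  have fin: "finite ?A"
    using finite_pverts_hypercube[of n] by simp
  have "{xs :: bool list. length xs = Suc n} = Cons True ` ?A \<union> Cons False ` ?A"
  proof (intro set_eqI iffI)
    fix xs :: "bool list" assume "xs \<in> {xs. length xs = Suc n}"
    then show "xs \<in> Cons True ` ?A \<union> Cons False ` ?A"
      by (cases xs; cases "hd xs") auto
  qed auto
  moreover have "sum f (Cons True ` ?A \<union> Cons False ` ?A)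
      = sum f (Cons True ` ?A) + sum f (Cons False ` ?A)"
    by (intro sum.union_disjoint) (use fin in auto)
  ultimately show ?thesis
    by (simp add: sum.reindex sum.distrib)
qed

text \<open>Every coordinate contributes a factor \<open>1 + 1/2\<close>.\<close>

lemma hamming_moment_0:
  fixes ts :: "bool list"
  shows "(\<Sum>xs | length xs = length ts. (1/2 :: real) ^ hamming xs ts) = (3/2) ^ length ts"
proof (induction ts)
  case (Cons t ts)
  have "(\<Sum>xs | length xs = length (t # ts). (1/2 :: real) ^ hamming xs (t # ts))
      = (\<Sum>xs | length xs = length ts. 3/2 * (1/2) ^ hamming xs ts)"
    unfolding length_Cons sum_length_Suc by (intro sum.cong refl; cases t) simp_all
  then show ?case
    unfolding sum_distrib_left[symmetric] Cons.IH by simp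
qed simp

text \<open>Under the normalised weight the coordinates are independent and each differs with
  probability 1/3. Thus \<open>3 * hamming - length\<close> is a centred sum with variance 2 per
  coordinate.\<close>

lemma hamming_moment_2:
  fixes ts :: "bool list"
  shows "(\<Sum>xs | length xs = length ts.
      (1/2 :: real) ^ hamming xs ts * (3 * real (hamming xs ts) - real (length ts))\<^sup>2)
    = 2 * real (length ts) * (3/2) ^ length ts"
proof (induction ts)
  case (Cons t ts)
  let ?g = "\<lambda>xs. (1/2 :: real) ^ hamming xs ts"
  let ?X = "\<lambda>xs. 3 * real (hamming xs ts) - real (length ts)"
  \<comment> \<open>A new coordinate shifts \<open>X\<close> by -1 (agreeing, weight 1) or by 2
    (differing, weight 1/2); the terms linear in \<open>X\<close> cancel.\<close>
  have eq: "g * (X - 1)\<^sup>2 + 1/2 * g * (X + 2)\<^sup>2 = 3/2 * (g * X\<^sup>2) + 3 * g" for g X :: real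
    by (simp add: power2_eq_square field_simps)
  have "(\<Sum>xs | length xs = length (t # ts). (1/2 :: real) ^ hamming xs (t # ts)
          * (3 * real (hamming xs (t # ts)) - real (length (t # ts)))\<^sup>2)
      = (\<Sum>xs | length xs = length ts. 3/2 * (?g xs * (?X xs)\<^sup>2) + 3 * ?g xs)"
    unfolding length_Cons sum_length_Suc
    by (intro sum.cong refl; subst eq[symmetric]; cases t) (simp_all add: algebra_simps)
  also have "\<dots> = 3/2 * (2 * real (length ts) * (3/2) ^ length ts) + 3 * (3/2) ^ length ts"
    by (simp only: sum.distrib sum_distrib_left[symmetric] Cons.IH hamming_moment_0)
  also have "\<dots> = 2 * real (length (t # ts)) * (3/2) ^ length (t # ts)"
    by (simp add: field_simps)
  finally show ?case .
qed simp

text \<open>The mean distance under the weight is \<open>length ts / 3\<close>, and \<open>u\<close>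
  bounds the deviation from it; multiplying by 3 avoids division.\<close>

definition near :: "nat \<Rightarrow> bool list \<Rightarrow> bool list \<Rightarrow> bool" where
  "near u xs ts \<longleftrightarrow> 3 * hamming xs ts \<le> length ts + 3 * u \<and> length ts \<le> 3 * hamming xs ts + 3 * u"

text \<open>Chebyshev's inequality: off the near region the squared deviation is at least
  \<open>9 * u^2\<close>, so the second moment bounds the lost weight.\<close>

lemma sum_near_ge:
  fixes ts :: "bool list"
  assumes "u > 0"
  shows "(\<Sum>xs | length xs = length ts. if near u xs ts then (1/2 :: real) ^ hamming xs ts else 0)
    \<ge> (3/2) ^ length ts * (1 - 2 * real (length ts) / (9 * (real u)\<^sup>2))"
proof -
  let ?g = "\<lambda>xs. (1/2 :: real) ^ hamming xs ts"
  let ?X = "\<lambda>xs. 3 * real (hamming xs ts) - real (length ts)"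
  have ineq: "?g xs - ?g xs * (?X xs)\<^sup>2 / (9 * (real u)\<^sup>2) \<le> (if near u xs ts then ?g xs else 0)" for xs
  proof (cases "near u xs ts")
    case False
    then have "3 * real u \<le> \<bar>?X xs\<bar>"
      unfolding near_def by linarith
    then have "(3 * real u)\<^sup>2 \<le> \<bar>?X xs\<bar>\<^sup>2"
      by (intro power_mono) auto
    then have "(3 * real u)\<^sup>2 \<le> (?X xs)\<^sup>2"
      by (simp only: power2_abs)
    then have "1 \<le> (?X xs)\<^sup>2 / (9 * (real u)\<^sup>2)"
      using assms by (simp add: power_mult_distrib)
    then have "?g xs * 1 \<le> ?g xs * ((?X xs)\<^sup>2 / (9 * (real u)\<^sup>2))"
      by (intro mult_left_mono) auto
    with False show ?thesis by simp
  qed auto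
  have "(3/2) ^ length ts * (1 - 2 * real (length ts) / (9 * (real u)\<^sup>2))
      = (\<Sum>xs | length xs = length ts. ?g xs)
        - (\<Sum>xs | length xs = length ts. ?g xs * (?X xs)\<^sup>2) / (9 * (real u)\<^sup>2)"
    unfolding hamming_moment_0 hamming_moment_2 by (simp add: field_simps)
  also have "\<dots> = (\<Sum>xs | length xs = length ts. ?g xs - ?g xs * (?X xs)\<^sup>2 / (9 * (real u)\<^sup>2))"
    by (simp add: sum_subtractf sum_divide_distrib)
  also have "\<dots> \<le> (\<Sum>xs | length xs = length ts. if near u xs ts then ?g xs else 0)"
    by (intro sum_mono ineq)
  finally show ?thesis .
qed

section \<open>Coverings with nearly optimal density\<close>

text \<open>Method of conditional expectations: averaged over \<open>x\<close> in \<open>V\<close>,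
  a further factor multiplies the sum by at most \<open>q\<close>, so some \<open>x\<close> does no
  worse than the average.\<close>

lemma greedy_product_bound:
  fixes f :: "'a \<Rightarrow> 'b \<Rightarrow> real" and q :: real
  assumes "finite V" "V \<noteq> {}" "finite T" "\<And>x t. 0 \<le> f x t"
    and avg: "\<And>t. t \<in> T \<Longrightarrow> (\<Sum>x\<in>V. f x t) \<le> q * card V"
  shows "\<exists>xs. length xs = N \<and> set xs \<subseteq> V \<and> (\<Sum>t\<in>T. \<Prod>x\<leftarrow>xs. f x t) \<le> q ^ N * card T"
proof (induction N)
  case 0
  then show ?case by simp
next
  case (Suc N)
  then obtain xs where xs: "length xs = N" "set xs \<subseteq> V"
    and le: "(\<Sum>t\<in>T. \<Prod>x\<leftarrow>xs. f x t) \<le> q ^ N * card T"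
    by blast
  define P where "P t = (\<Prod>x\<leftarrow>xs. f x t)" for t
  have P0: "0 \<le> P t" for t
    unfolding P_def by (rule prod_list_nonneg) (use assms(4) in auto)
  \<comment> \<open>The sign of \<open>q\<close> follows from \<open>avg\<close> at some
    \<open>t\<close>, hence the separate case of empty \<open>T\<close> below.\<close>
  have q0: "0 \<le> q" if "t \<in> T" for t
  proof -
    have "0 \<le> q * card V"
      using avg[OF that] sum_nonneg[of V "\<lambda>x. f x t"] assms(4) by (meson order_trans)
    moreover have "0 < card V"
      using assms(1,2) by (simp add: card_gt_0_iff)
    ultimately show ?thesis
      by (simp add: zero_le_mult_iff)
  qed
  have "(\<Sum>x\<in>V. \<Sum>t\<in>T. f x t * P t) = (\<Sum>t\<in>T. (\<Sum>x\<in>V. f x t) * P t)"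
    by (subst sum.swap) (simp add: sum_distrib_right)
  also have "\<dots> \<le> (\<Sum>t\<in>T. q * card V * P t)"
    by (intro sum_mono mult_right_mono avg P0)
  also have "\<dots> = (\<Sum>x\<in>V. q * sum P T)"
    by (simp add: sum_distrib_left mult_ac)
  finally have "\<exists>x\<in>V. (\<Sum>t\<in>T. f x t * P t) \<le> q * sum P T"
    using sum_strict_mono[OF assms(1,2), of "\<lambda>_. q * sum P T" "\<lambda>x. \<Sum>t\<in>T. f x t * P t"]
    by (meson not_le)
  then obtain x where x: "x \<in> V" "(\<Sum>t\<in>T. f x t * P t) \<le> q * sum P T"
    by blast
  have "q * sum P T \<le> q * (q ^ N * card T)"
  proof (cases "T = {}")
    case False
    with q0 le show ?thesis
      unfolding P_def[symmetric] by (auto intro!: mult_left_mono)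
  qed simp
  then show ?case
    using x xs by (intro exI[of _ "x # xs"]) (auto simp: P_def)
qed

text \<open>Chernoff's bound, derandomised through the greedy choice above.\<close>

lemma ex_dense_covering:
  fixes w :: "'a \<Rightarrow> 'b \<Rightarrow> nat" and \<mu> \<delta> K W :: real
  assumes V: "finite V" "V \<noteq> {}" and T: "finite T"
    and W: "0 < W" "\<And>x t. real (w x t) \<le> W" and \<delta>: "0 < \<delta>" "\<delta> < 1"
    and avg: "\<And>t. t \<in> T \<Longrightarrow> \<mu> * card V \<le> (\<Sum>x\<in>V. real (w x t))"
    and N: "K + W / \<delta> * ln (card T) \<le> (1 - \<delta>) * \<mu> * real N"
  shows "\<exists>xs. length xs = N \<and> set xs \<subseteq> V \<and> (\<forall>t\<in>T. K \<le> (\<Sum>x\<leftarrow>xs. real (w x t)))"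
proof -
  \<comment> \<open>The largest exponent that keeps \<open>l * w x t\<close> below \<delta>, where
    the linear bound \<open>pw\<close> is valid. The union bound over \<open>T\<close> then costs
    \<open>ln (card T) / l\<close>.\<close>
  define l where "l = \<delta> / W"
  have l: "0 < l"
    using \<delta> W by (simp add: l_def)
  define q where "q = exp (- (l * (1 - \<delta>) * \<mu>))"
  have pw: "exp (- (l * real (w x t))) \<le> 1 - l * (1 - \<delta>) * real (w x t)" for x t
  proof -
    define y where "y = l * real (w x t)"
    have y: "0 \<le> y" "y \<le> \<delta>"
      using W(2)[of x t] l \<delta> W(1) by (auto simp: y_def l_def field_simps)
    have "1 \<le> (1 + y) * (1 - (1 - \<delta>) * y)"
    proof -
      have "0 \<le> y * (\<delta> - y) + \<delta> * (y * y)"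
        using y \<delta> by (intro add_nonneg_nonneg mult_nonneg_nonneg) auto
      then show ?thesis by (simp add: algebra_simps)
    qed
    then have "inverse (1 + y) \<le> 1 - (1 - \<delta>) * y"
      using y by (simp add: field_simps)
    moreover have "exp (- y) \<le> inverse (1 + y)"
      unfolding exp_minus using y by (intro le_imp_inverse_le exp_ge_add_one_self) auto
    ultimately show ?thesis
      by (simp add: y_def mult_ac)
  qed
  have "\<exists>xs. length xs = N \<and> set xs \<subseteq> V \<and>
      (\<Sum>t\<in>T. \<Prod>x\<leftarrow>xs. exp (- (l * real (w x t)))) \<le> q ^ N * card T"
  proof (rule greedy_product_bound[OF V T])
    fix t assume t: "t \<in> T"
    have "(\<Sum>x\<in>V. exp (- (l * real (w x t)))) \<le> (\<Sum>x\<in>V. 1 - l * (1 - \<delta>) * real (w x t))"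
      by (intro sum_mono pw)
    also have "\<dots> = card V - l * (1 - \<delta>) * (\<Sum>x\<in>V. real (w x t))"
      by (simp add: sum_subtractf sum_distrib_left)
    also have "\<dots> \<le> card V - l * (1 - \<delta>) * (\<mu> * card V)"
      using avg[OF t] l \<delta> by (intro diff_left_mono mult_left_mono) auto
    also have "\<dots> = (1 + - (l * (1 - \<delta>) * \<mu>)) * card V"
      by (simp add: algebra_simps)
    also have "\<dots> \<le> q * card V"
      unfolding q_def by (intro mult_right_mono exp_ge_add_one_self) auto
    finally show "(\<Sum>x\<in>V. exp (- (l * real (w x t)))) \<le> q * card V" .
  qed auto
  then obtain xs where xs: "length xs = N" "set xs \<subseteq> V"
    and le: "(\<Sum>t\<in>T. \<Prod>x\<leftarrow>xs. exp (- (l * real (w x t)))) \<le> q ^ N * card T"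
    by blast
  have prod_exp: "(\<Prod>x\<leftarrow>ys. exp (- (l * real (w x t)))) = exp (- (l * (\<Sum>x\<leftarrow>ys. real (w x t))))"
    for ys t
    by (induction ys) (auto simp: algebra_simps simp flip: exp_add)
  have "K \<le> (\<Sum>x\<leftarrow>xs. real (w x t))" if t: "t \<in> T" for t
  proof -
    let ?S = "\<Sum>x\<leftarrow>xs. real (w x t)"
    have cT: "0 < real (card T)"
      using t T by (auto simp: card_gt_0_iff)
    \<comment> \<open>One target's term is at most the whole sum; comparing exponents then bounds
      \<open>?S\<close> from below.\<close>
    have "exp (- (l * ?S)) \<le> (\<Sum>t\<in>T. exp (- (l * (\<Sum>x\<leftarrow>xs. real (w x t)))))"
      by (rule member_le_sum[OF t]) (use T in auto)
    also have "\<dots> \<le> q ^ N * card T"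
      using le by (simp add: prod_exp)
    also have "\<dots> = exp (real N * - (l * (1 - \<delta>) * \<mu>) + ln (card T))"
      using cT by (simp only: q_def exp_add exp_of_nat_mult exp_ln)
    finally have "l * ((1 - \<delta>) * \<mu> * real N) - ln (card T) \<le> l * ?S"
      by (simp add: algebra_simps)
    moreover have "l * (K + W / \<delta> * ln (card T)) \<le> l * ((1 - \<delta>) * \<mu> * real N)"
      using N l by (intro mult_left_mono) auto
    moreover have "l * (K + W / \<delta> * ln (card T)) = l * K + ln (card T)"
      using W \<delta> by (simp add: l_def field_simps)
    ultimately have "l * K \<le> l * ?S" by linarith
    with l show ?thesis by simp
  qed
  with xs show ?thesis by blast
qed


section \<open>Coverings of a cube by piles of pebbles\<close>

text \<open>What a pile of \<open>2 ^ (length ts div 3 + u)\<close> pebbles at \<open>xs\<close>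
  delivers to \<open>ts\<close>. Dropping the other distances caps the weight, as the Chernoff bound
  requires.\<close>

definition pile_weight :: "nat \<Rightarrow> bool list \<Rightarrow> bool list \<Rightarrow> nat" where
  "pile_weight u xs ts = (if near u xs ts then 2 ^ (length ts div 3 + u - hamming xs ts) else 0)"

lemma near_hamming_le: "near u xs ts \<Longrightarrow> hamming xs ts \<le> length ts div 3 + u"
  unfolding near_def by linarith

lemma pile_weight_le: "pile_weight u xs ts \<le> 2 ^ (2 * u)"
proof -
  have "length ts div 3 + u - hamming xs ts \<le> 2 * u" if "near u xs ts"
    using that unfolding near_def by linarith
  then show ?thesis
    unfolding pile_weight_def by (auto intro: power_increasing)
qed

text \<open>At near distances the subtraction in the exponent is not truncated. This makes the
  weights admissible in \<open>attainable_product\<close>.\<close>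

lemma hamming_pile_weight_le:
  "2 ^ hamming xs ts * pile_weight u xs ts \<le> 2 ^ (length ts div 3 + u)"
  using near_hamming_le[of u xs ts] by (simp add: pile_weight_def flip: power_add)

lemma sum_pile_weight_ge:
  fixes ts :: "bool list"
  assumes "u > 0"
  shows "2 ^ (length ts div 3 + u) * (3/2) ^ length ts * (1 - 2 * real (length ts) / (9 * (real u)\<^sup>2))
    \<le> (\<Sum>xs | length xs = length ts. real (pile_weight u xs ts))"
proof -
  let ?J = "length ts div 3 + u"
  have "real (pile_weight u xs ts) = 2 ^ ?J * (if near u xs ts then (1/2) ^ hamming xs ts else 0)" for xs
  proof (cases "near u xs ts")
    case True
    then have "(2 :: real) ^ (?J - hamming xs ts) = 2 ^ ?J / 2 ^ hamming xs ts"
      by (intro power_diff near_hamming_le) auto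
    with True show ?thesis by (simp add: pile_weight_def power_one_over)
  qed (simp add: pile_weight_def)
  then have "(\<Sum>xs | length xs = length ts. real (pile_weight u xs ts))
      = 2 ^ ?J * (\<Sum>xs | length xs = length ts. if near u xs ts then (1/2) ^ hamming xs ts else 0)"
    by (simp only: sum_distrib_left)
  also have "\<dots> \<ge> 2 ^ ?J * ((3/2) ^ length ts * (1 - 2 * real (length ts) / (9 * (real u)\<^sup>2)))"
    by (intro mult_left_mono sum_near_ge assms) simp
  finally show ?thesis by (simp only: mult.assoc)
qed

text \<open>Holds since \<open>(4/3)^3 = 64/27\<close> exceeds 2. It bounds the one extra pile
  caused by rounding up.\<close>

lemma two_power_div_3_le: "(2 :: real) ^ (n div 3) \<le> (4/3) ^ n"
proof -
  have "(2 :: real) ^ (n div 3) \<le> ((4/3) ^ 3) ^ (n div 3)"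
    by (intro power_mono) (auto simp: power3_eq_cube)
  also have "\<dots> = (4/3) ^ (3 * (n div 3))"
    by (simp only: power_mult)
  also have "\<dots> \<le> (4/3) ^ n"
    by (intro power_increasing) auto
  finally show ?thesis .
qed

lemma power_le_two_power:
  assumes "m * c \<le> l"
  shows "real c ^ m \<le> 2 ^ l"
proof -
  have "real c ^ m \<le> (2 ^ c) ^ m"
    using of_nat_less_two_power[of c, where 'a=real] by (intro power_mono) auto
  also have "\<dots> \<le> 2 ^ l"
    using assms by (simp add: mult.commute flip: power_mult)
  finally show ?thesis .
qed

text \<open>With \<delta> = \<open>1/c^2\<close>, the Chebyshev tail and the linearised exponential
  each cost a factor 1 - \<delta>, the union bound costs 1 + \<delta>, and rounding up adds
  \<delta>. Together they stay below 1 + 5\<delta>.\<close>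

lemma ex_pile_covering:
  assumes c: "20 \<le> c" and a: "a \<le> c ^ 4"
  shows "\<exists>xs. set xs \<subseteq> {xs. length xs = a} \<and>
    real (length xs) * 2 ^ (a div 3 + c ^ 3) \<le> (1 + 5 / (real c)\<^sup>2) * 2 ^ (4 * c ^ 3) * (4/3) ^ a \<and>
    (\<forall>t. length t = a \<longrightarrow> 2 ^ (4 * c ^ 3) \<le> (\<Sum>x\<leftarrow>xs. pile_weight (c ^ 3) x t))"
proof -
  define u where "u = c ^ 3"
  define j where "j = a div 3 + u"
  define \<delta> where "\<delta> = 1 / (real c)\<^sup>2"
  define K where "K = (2 :: real) ^ (4 * u)"
  \<comment> \<open>Lower bound for the average weight of a position: total weight about
    \<open>(3/2)^a\<close> spread over \<open>2^a\<close> vertices, times the pile size, less the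
    tail.\<close>
  define \<mu> where "\<mu> = 2 ^ j * (3/4) ^ a * (1 - \<delta>)"
  define N where "N = nat \<lceil>(1 + \<delta>) * K / ((1 - \<delta>) * \<mu>)\<rceil>"
  let ?V = "{xs :: bool list. length xs = a}"
  have u0: "u > 0" using c by (simp add: u_def)
  have c2: "400 \<le> c\<^sup>2"
    using power_mono[OF c, of 2] by simp
  have c2': "400 \<le> (real c)\<^sup>2"
    using c2 by (metis of_nat_le_iff of_nat_numeral of_nat_power)
  have \<delta>: "0 < \<delta>" "\<delta> \<le> 1/400"
    using c c2' by (auto simp: \<delta>_def divide_simps)
  have K0: "0 < K" by (simp add: K_def)
  have \<mu>0: "0 < \<mu>" using \<delta> by (simp add: \<mu>_def)
  have cu: "400 * c \<le> u"
    using mult_right_mono[OF c2, of c] by (simp add: u_def power3_eq_cube power2_eq_square)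
  have card: "real (card ?V) = 2 ^ a"
    using card_lists_length_eq[of "UNIV :: bool set" a] by simp
  have fin: "finite ?V"
    using finite_pverts_hypercube[of a] by simp
  have ne: "?V \<noteq> {}"
    by (auto intro: exI[of _ "replicate a True"])
  have tail: "2 * real a / (9 * (real u)\<^sup>2) \<le> \<delta>"
  proof -
    have "real a \<le> real c ^ 4"
      using a by (metis of_nat_le_iff of_nat_power)
    then have "2 * real a \<le> 9 * real c ^ 4"
      by linarith
    then have "2 * real a * (real c)\<^sup>2 \<le> (9 * real c ^ 4) * (real c)\<^sup>2"
      by (rule mult_right_mono) simp
    also have "\<dots> = 9 * (real u)\<^sup>2"
      by (simp add: u_def power_numeral_reduce)
    finally show ?thesis
      using u0 c by (simp add: \<delta>_def divide_simps)
  qed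
  have avg: "\<mu> * card ?V \<le> (\<Sum>x\<in>?V. real (pile_weight u x t))" if "t \<in> ?V" for t
  proof -
    have "\<mu> * card ?V = 2 ^ j * (3/2) ^ a * (1 - \<delta>)"
    proof -
      have "(3/4 :: real) ^ a * 2 ^ a = (3/2) ^ a"
        by (simp flip: power_mult_distrib)
      then show ?thesis
        unfolding \<mu>_def card by simp
    qed
    also have "\<dots> \<le> 2 ^ j * (3/2) ^ a * (1 - 2 * real a / (9 * (real u)\<^sup>2))"
      using tail by (intro mult_left_mono) auto
    also have "\<dots> \<le> (\<Sum>x\<in>?V. real (pile_weight u x t))"
      using sum_pile_weight_ge[OF u0, of t] that by (simp add: j_def)
    finally show ?thesis .
  qed
  have N1: "(1 + \<delta>) * K \<le> (1 - \<delta>) * \<mu> * real N"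
  proof -
    have "(1 + \<delta>) * K / ((1 - \<delta>) * \<mu>) \<le> real N"
      unfolding N_def by (rule real_nat_ceiling_ge)
    moreover have "0 < (1 - \<delta>) * \<mu>"
      using \<mu>0 \<delta> by simp
    ultimately show ?thesis
      by (simp add: pos_divide_le_eq mult_ac)
  qed
  \<comment> \<open>The union bound is negligible: after clearing \<delta>, only \<open>c^8\<close>
    has to be at most \<open>2 ^ (2 * u)\<close>, and \<open>u = c^3\<close>.\<close>
  have dev: "2 ^ (2 * u) / \<delta> * ln (card ?V) \<le> \<delta> * K"
  proof -
    have "ln (card ?V) \<le> real a"
    proof -
      have "ln (card ?V) = real a * ln 2"
        unfolding card by (simp add: ln_realpow)
      also have "\<dots> \<le> real a * 1"
        using ln_le_minus_one[of "2 :: real"] by (intro mult_left_mono) auto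
      finally show ?thesis by simp
    qed
    also have "real a \<le> real c ^ 4"
      using a by (metis of_nat_le_iff of_nat_power)
    finally have "2 ^ (2 * u) / \<delta> * ln (card ?V) \<le> 2 ^ (2 * u) / \<delta> * real c ^ 4"
      using \<delta> by (intro mult_left_mono) auto
    also have "\<dots> = \<delta> * (2 ^ (2 * u) * real c ^ 8)"
      using c by (simp add: \<delta>_def field_simps flip: power_add)
    also have "\<dots> \<le> \<delta> * (2 ^ (2 * u) * 2 ^ (2 * u))"
      using \<delta> cu by (intro mult_left_mono power_le_two_power) auto
    also have "\<dots> = \<delta> * K"
      by (simp add: K_def flip: power_add)
    finally show ?thesis .
  qed
  have "\<exists>xs. length xs = N \<and> set xs \<subseteq> ?V \<and> (\<forall>t\<in>?V. K \<le> (\<Sum>x\<leftarrow>xs. real (pile_weight u x t)))"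
  proof (rule ex_dense_covering[OF fin ne fin, where W = "2 ^ (2 * u)" and \<delta> = \<delta> and \<mu> = \<mu>])
    show "real (pile_weight u x t) \<le> 2 ^ (2 * u)" for x t
      using pile_weight_le[of u x t] by (metis of_nat_le_iff of_nat_numeral of_nat_power)
    show "K + 2 ^ (2 * u) / \<delta> * ln (card ?V) \<le> (1 - \<delta>) * \<mu> * real N"
      using N1 dev by (simp add: algebra_simps)
  qed (use \<delta> avg in auto)
  then obtain xs where xs: "length xs = N" "set xs \<subseteq> ?V"
    and cov: "\<And>t. length t = a \<Longrightarrow> K \<le> (\<Sum>x\<leftarrow>xs. real (pile_weight u x t))"
    by blast
  have "real N * 2 ^ j \<le> ((1 + \<delta>) * K / ((1 - \<delta>) * \<mu>) + 1) * 2 ^ j"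
  proof (rule mult_right_mono)
    have "0 \<le> (1 + \<delta>) * K / ((1 - \<delta>) * \<mu>)"
      using \<delta> K0 \<mu>0 by simp
    then show "real N \<le> (1 + \<delta>) * K / ((1 - \<delta>) * \<mu>) + 1"
      unfolding N_def by linarith
  qed simp
  also have "\<dots> = (1 + \<delta>) / (1 - \<delta>)\<^sup>2 * (K * (4/3) ^ a) + 2 ^ j"
  proof -
    have "(1 + \<delta>) * K / ((1 - \<delta>) * \<mu>) * 2 ^ j = (1 + \<delta>) / (1 - \<delta>)\<^sup>2 * (K * (1 / (3/4) ^ a))"
      using \<delta> by (simp add: \<mu>_def power2_eq_square)
    also have "1 / (3/4 :: real) ^ a = (4/3) ^ a"
      by (simp add: power_divide)
    finally show ?thesis by (simp add: distrib_right)
  qed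
  also have "\<dots> \<le> (1 + 4 * \<delta>) * (K * (4/3) ^ a) + \<delta> * (K * (4/3) ^ a)"
  proof (intro add_mono mult_right_mono)
    \<comment> \<open>This product is (1 + 4\<delta>)(1 - \<delta>)^2 - (1 + \<delta>),
      expanded.\<close>
    have "0 \<le> \<delta> * (1 - 7 * \<delta> + 4 * \<delta>\<^sup>2)"
      using \<delta> by (intro mult_nonneg_nonneg add_nonneg_nonneg) auto
    then have "1 + \<delta> \<le> (1 + 4 * \<delta>) * (1 - \<delta>)\<^sup>2"
      by (simp add: algebra_simps power2_eq_square)
    then show "(1 + \<delta>) / (1 - \<delta>)\<^sup>2 \<le> 1 + 4 * \<delta>"
      using \<delta> by (simp add: pos_divide_le_eq)
    have "2 ^ u * (real c)\<^sup>2 \<le> 2 ^ u * 2 ^ (3 * u)"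
      using cu by (intro mult_left_mono power_le_two_power) auto
    also have "\<dots> = K"
      by (simp add: K_def flip: power_add)
    finally have "2 ^ u \<le> \<delta> * K"
      using c by (simp add: \<delta>_def pos_le_divide_eq)
    then have "2 ^ u * 2 ^ (a div 3) \<le> \<delta> * K * (4/3) ^ a"
      using \<delta> K0 by (intro mult_mono two_power_div_3_le) auto
    then show "2 ^ j \<le> \<delta> * (K * (4/3) ^ a)"
      by (simp add: j_def power_add mult_ac)
  qed (use K0 in auto)
  also have "\<dots> = (1 + 5 / (real c)\<^sup>2) * K * (4/3) ^ a"
    by (simp add: \<delta>_def algebra_simps add_divide_distrib)
  finally have cost: "real (length xs) * 2 ^ j \<le> (1 + 5 / (real c)\<^sup>2) * K * (4/3) ^ a"
    using xs by simp
  have "2 ^ (4 * u) \<le> (\<Sum>x\<leftarrow>xs. pile_weight u x t)" if "length t = a" for t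
  proof -
    have "real (\<Sum>x\<leftarrow>xs. pile_weight u x t) = (\<Sum>x\<leftarrow>xs. real (pile_weight u x t))"
      by (induction xs) auto
    then have "real (2 ^ (4 * u)) \<le> real (\<Sum>x\<leftarrow>xs. pile_weight u x t)"
      using cov[OF that] by (simp only: K_def of_nat_power of_nat_numeral)
    then show ?thesis by (simp only: of_nat_le_iff)
  qed
  with xs cost show ?thesis
    unfolding u_def j_def K_def by blast
qed

section \<open>Products of distributions\<close>

definition fiber :: "'a list \<Rightarrow> ('a list \<Rightarrow> nat) \<Rightarrow> 'a list \<Rightarrow> nat" where
  "fiber xs D zs = (if take (length xs) zs = xs then D (drop (length xs) zs) else 0)"

lemma fiber_append [simp]: "fiber xs D (xs @ ss) = D ss"
  by (simp add: fiber_def)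

lemma fiber_upd: "fiber xs (D(us := k)) = (fiber xs D)(xs @ us := k)"
proof
  fix zs
  have "take (length xs) zs = xs \<longleftrightarrow> zs = xs @ drop (length xs) zs"
    by (metis append_eq_conv_conj append_take_drop_id)
  then show "fiber xs (D(us := k)) zs = ((fiber xs D)(xs @ us := k)) zs"
    by (auto simp: fiber_def)
qed

lemma pebbling_move_fiber:
  assumes "pebbling_move (hypercube b) D D'"
  shows "pebbling_move (hypercube (length xs + b)) (fiber xs D) (fiber xs D')"
proof -
  obtain u v where uv: "(u, v) \<in> parcs (hypercube b)" "2 \<le> D u" "D' = D(u := D u - 2, v := D v + 1)"
    using assms unfolding pebbling_move_def by blast
  then show ?thesis
    unfolding pebbling_move_def
    by (intro exI[of _ "xs @ u"] exI[of _ "xs @ v"]) (auto simp: parcs_hypercube_iff fiber_upd)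
qed

lemma reach_fiber:
  assumes "reach (hypercube b) D k s"
  shows "reach (hypercube (length xs + b)) (fiber xs D) k (xs @ s)"
proof -
  have "(pebbling_move (hypercube (length xs + b)))\<^sup>*\<^sup>* (fiber xs D) (fiber xs D')"
    if "(pebbling_move (hypercube b))\<^sup>*\<^sup>* D D'" for D'
    using that
    by (induction rule: rtranclp_induct) (auto intro: rtranclp.rtrancl_into_rtrancl pebbling_move_fiber)
  with assms show ?thesis
    unfolding reach_def by (metis fiber_append)
qed

lemma pebbling_size_fiber:
  fixes xs :: "bool list"
  shows "pebbling_size (hypercube (length xs + b)) (fiber xs D) = pebbling_size (hypercube b) D"
proof -
  let ?B = "{ss :: bool list. length ss = b}" and ?A = "{zs :: bool list. length zs = length xs + b}"
  have "sum (fiber xs D) ?A = sum (fiber xs D) ((@) xs ` ?B)"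
  proof (rule sum.mono_neutral_right)
    show "finite ?A"
      using finite_pverts_hypercube[of "length xs + b"] by simp
    show "\<forall>zs\<in>?A - (@) xs ` ?B. fiber xs D zs = 0"
    proof
      fix zs assume zs: "zs \<in> ?A - (@) xs ` ?B"
      have "zs \<in> (@) xs ` ?B" if "take (length xs) zs = xs"
        using that zs by (intro image_eqI[of _ _ "drop (length xs) zs"])
          (auto, metis append_take_drop_id)
      with zs show "fiber xs D zs = 0" by (auto simp: fiber_def)
    qed
  qed auto
  also have "\<dots> = sum D ?B"
    by (simp add: sum.reindex inj_on_def)
  finally show ?thesis by (simp add: pebbling_size_def)
qed

lemma pebbling_size_sum_list:
  "pebbling_size G (\<lambda>v. \<Sum>x\<leftarrow>xs. D x v) = (\<Sum>x\<leftarrow>xs. pebbling_size G (D x))"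
  by (induction xs) (auto simp: pebbling_size_def sum.distrib)

section \<open>Cost of delivering \<open>k\<close> pebbles to every vertex\<close>

definition attainable :: "nat \<Rightarrow> nat \<Rightarrow> real \<Rightarrow> bool" where
  "attainable n k B \<longleftrightarrow> (\<exists>D. real (pebbling_size (hypercube n) D) \<le> B \<and>
     (\<forall>t. length t = n \<longrightarrow> reach (hypercube n) D k t))"

lemma attainable_mono: "attainable n k B \<Longrightarrow> B \<le> B' \<Longrightarrow> attainable n k B'"
  unfolding attainable_def by (meson order_trans)

lemma attainable_0: "attainable 0 k (real k)"
  unfolding attainable_def
  by (rule exI[of _ "\<lambda>_. k"]) (auto simp: pebbling_size_def intro: reach_self)

lemma attainable_mult:
  assumes "attainable n k B"
  shows "attainable n (M * k) (real M * B)"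
proof -
  obtain D where D: "real (pebbling_size (hypercube n) D) \<le> B"
    "\<And>t. length t = n \<Longrightarrow> reach (hypercube n) D k t"
    using assms unfolding attainable_def by blast
  have "reach (hypercube n) (\<lambda>v. M * D v) (M * k) t" if "length t = n" for t
  proof (induction M)
    case (Suc M)
    show ?case
      using reach_add[OF D(2)[OF that] Suc.IH] by simp
  qed simp
  moreover have "real (pebbling_size (hypercube n) (\<lambda>v. M * D v)) \<le> real M * B"
    using D(1) by (simp add: pebbling_size_def mult_left_mono flip: sum_distrib_left)
  ultimately show ?thesis
    unfolding attainable_def by blast
qed

text \<open>Put a copy of \<open>D\<close> on the fiber over each \<open>x\<close>. For a target
  \<open>t @ s\<close>, each copy first gathers \<open>m\<close> pebbles at \<open>x @ s\<close>,
  then sends them along the first factor, where \<open>w x t\<close> of them survive; the copies add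
  up.\<close>

lemma attainable_product:
  fixes xs :: "bool list list"
  assumes att: "attainable b m B"
    and xs: "set xs \<subseteq> {xs. length xs = a}"
    and w: "\<And>x t. length t = a \<Longrightarrow> 2 ^ hamming x t * w x t \<le> m"
    and cov: "\<And>t. length t = a \<Longrightarrow> k \<le> (\<Sum>x\<leftarrow>xs. w x t)"
  shows "attainable (a + b) k (real (length xs) * B)"
proof -
  obtain D where D: "real (pebbling_size (hypercube b) D) \<le> B"
    "\<And>s. length s = b \<Longrightarrow> reach (hypercube b) D m s"
    using att unfolding attainable_def by blast
  let ?E = "\<lambda>v. \<Sum>x\<leftarrow>xs. fiber x D v"
  have "reach (hypercube (a + b)) ?E k z" if z: "length z = a + b" for z
  proof -
    define t s where "t = take a z" and "s = drop a z"
    have ts: "z = t @ s" "length t = a" "length s = b"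
      using z by (auto simp: t_def s_def)
    have "reach (hypercube (a + b)) ?E (\<Sum>x\<leftarrow>xs. w x t) z"
    proof (rule reach_sum_list)
      fix x assume "x \<in> set xs"
      then have x: "length x = a" using xs by auto
      have "reach (hypercube (a + b)) (fiber x D) m (x @ s)"
        using reach_fiber[OF D(2)[OF ts(3)], of x] x by simp
      then have "reach (hypercube (a + b)) (fiber x D) (2 ^ hamming x t * w x t) ([] @ x @ s)"
        using w[OF ts(2)] by (auto intro: reach_mono)
      then have "reach (hypercube (a + b)) (fiber x D) (w x t) ([] @ t @ s)"
        by (rule reach_hamming[rotated 2]) (use x ts in auto)
      then show "reach (hypercube (a + b)) (fiber x D) (w x t) z"
        using ts by simp
    qed
    then show ?thesis
      using cov[OF ts(2)] by (rule reach_mono)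
  qed
  moreover have "real (pebbling_size (hypercube (a + b)) ?E) \<le> real (length xs) * B"
  proof -
    have "(\<Sum>x\<leftarrow>xs. pebbling_size (hypercube (a + b)) (fiber x D))
        = (\<Sum>x\<leftarrow>xs. pebbling_size (hypercube b) D)"
      using xs pebbling_size_fiber[of _ b D] by (intro arg_cong[of _ _ sum_list] map_cong) auto
    then show ?thesis
      using D(1) by (simp add: pebbling_size_sum_list sum_list_triv mult_left_mono)
  qed
  ultimately show ?thesis
    unfolding attainable_def by blast
qed

section \<open>The two bounds\<close>

text \<open>Induction on \<open>n\<close> with \<open>c\<close> arbitrary, as the remaining factor
  is treated with \<open>c + 1\<close>. The bound \<open>exp (5 / (c - 1))\<close> absorbs all later
  loss factors.\<close>

lemma attainable_power:
  assumes "20 \<le> c"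
  shows "attainable n (2 ^ (4 * c ^ 3)) (exp (5 / (real c - 1)) * 2 ^ (4 * c ^ 3) * (4/3) ^ n)"
  using assms
proof (induction n arbitrary: c rule: less_induct)
  case (less n)
  note c = less.prems
  define a where "a = min n (c ^ 4)"
  define b where "b = n - a"
  define j where "j = a div 3 + c ^ 3"
  have ab: "n = a + b" "a \<le> c ^ 4" by (auto simp: a_def b_def)
  \<comment> \<open>If \<open>n\<close> is at most \<open>c^4\<close>, nothing remains and each pile
    stays as it is. Otherwise the hypothesis for \<open>c + 1\<close> is scaled up to
    \<open>2 ^ j\<close> pebbles.\<close>
  have rest: "attainable b (2 ^ j) (2 ^ j * exp (5 / real c) * (4/3) ^ b)"
  proof (cases "n \<le> c ^ 4")
    case True
    then have "b = 0" by (simp add: a_def b_def)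
    have "attainable 0 (2 ^ j) (real (2 ^ j))" by (rule attainable_0)
    then have "attainable 0 (2 ^ j) (2 ^ j * exp (5 / real c))"
      by (rule attainable_mono) auto
    with \<open>b = 0\<close> show ?thesis by simp
  next
    case False
    then have aeq: "a = c ^ 4" by (simp add: a_def)
    have "b < n" using False c by (simp add: b_def aeq)
    let ?e = "4 * (c + 1) ^ 3"
    \<comment> \<open>This is where \<open>a = c^4\<close> is large enough:
      \<open>c^4 / 3 + c^3\<close> outgrows \<open>4 * (c + 1)^3\<close> from \<open>c = 20\<close>
      on.\<close>
    have ej: "?e \<le> j"
    proof -
      have *: "20 * c ^ 3 \<le> c ^ 4" "20 * c ^ 2 \<le> c ^ 3" "20 * c \<le> c ^ 2" "20 \<le> c"
        using c by (auto simp: power_numeral_reduce)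
      have "(c + 1) ^ 3 = c ^ 3 + 3 * c ^ 2 + 3 * c + 1"
        by (simp add: power_numeral_reduce algebra_simps)
      with * show ?thesis unfolding j_def aeq by linarith
    qed
    have "attainable b (2 ^ ?e) (exp (5 / (real (c + 1) - 1)) * 2 ^ ?e * (4/3) ^ b)"
      using \<open>b < n\<close> c by (intro less.IH) auto
    then have "attainable b (2 ^ (j - ?e) * 2 ^ ?e)
        (real (2 ^ (j - ?e)) * (exp (5 / (real (c + 1) - 1)) * 2 ^ ?e * (4/3) ^ b))"
      by (rule attainable_mult)
    moreover have "(2 :: nat) ^ (j - ?e) * 2 ^ ?e = 2 ^ j"
      using ej by (simp flip: power_add)
    moreover have "real (2 ^ (j - ?e)) * (exp (5 / (real (c + 1) - 1)) * 2 ^ ?e * (4/3) ^ b)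
        = 2 ^ j * exp (5 / real c) * (4/3) ^ b"
    proof -
      have "(2 :: real) ^ j = 2 ^ (j - ?e) * 2 ^ ?e"
        using ej by (simp flip: power_add)
      then show ?thesis by simp
    qed
    ultimately show ?thesis by (simp only:)
  qed
  obtain xs where xs: "set xs \<subseteq> {xs. length xs = a}"
    and cost: "real (length xs) * 2 ^ j \<le> (1 + 5 / (real c)\<^sup>2) * 2 ^ (4 * c ^ 3) * (4/3) ^ a"
    and cov: "\<And>t. length t = a \<Longrightarrow> 2 ^ (4 * c ^ 3) \<le> (\<Sum>x\<leftarrow>xs. pile_weight (c ^ 3) x t)"
    using ex_pile_covering[OF c ab(2)] unfolding j_def by blast
  have "attainable (a + b) (2 ^ (4 * c ^ 3)) (real (length xs) * (2 ^ j * exp (5 / real c) * (4/3) ^ b))"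
  proof (rule attainable_product[OF rest xs _ cov])
    show "2 ^ hamming x t * pile_weight (c ^ 3) x t \<le> 2 ^ j" if "length t = a" for x t
      using hamming_pile_weight_le[of x t "c ^ 3"] that by (simp add: j_def)
  qed
  then show ?case
    unfolding ab(1)[symmetric]
  proof (rule attainable_mono)
    \<comment> \<open>The exponents telescope: \<open>5/c^2\<close> is at most
      \<open>5/(c-1) - 5/c\<close>.\<close>
    have loss: "(1 + 5 / (real c)\<^sup>2) * exp (5 / real c) \<le> exp (5 / (real c - 1))"
    proof -
      have "(1 + 5 / (real c)\<^sup>2) * exp (5 / real c) \<le> exp (5 / (real c)\<^sup>2) * exp (5 / real c)"
        by (intro mult_right_mono exp_ge_add_one_self) auto
      also have "\<dots> = exp (5 / (real c)\<^sup>2 + 5 / real c)"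
        by (simp add: exp_add)
      also have "5 / (real c)\<^sup>2 + 5 / real c \<le> 5 / (real c - 1)"
        using c by (simp add: divide_simps power2_eq_square algebra_simps)
      finally show ?thesis by simp
    qed
    have "real (length xs) * (2 ^ j * exp (5 / real c) * (4/3) ^ b)
        = (real (length xs) * 2 ^ j) * (exp (5 / real c) * (4/3) ^ b)"
      by simp
    also have "\<dots> \<le> ((1 + 5 / (real c)\<^sup>2) * 2 ^ (4 * c ^ 3) * (4/3) ^ a) * (exp (5 / real c) * (4/3) ^ b)"
      by (intro mult_right_mono cost) auto
    also have "\<dots> = ((1 + 5 / (real c)\<^sup>2) * exp (5 / real c)) * (2 ^ (4 * c ^ 3) * (4/3) ^ n)"
      by (simp add: ab(1) power_add)
    also have "\<dots> \<le> exp (5 / (real c - 1)) * (2 ^ (4 * c ^ 3) * (4/3) ^ n)"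
      by (intro mult_right_mono loss) auto
    finally show "real (length xs) * (2 ^ j * exp (5 / real c) * (4/3) ^ b)
        \<le> exp (5 / (real c - 1)) * 2 ^ (4 * c ^ 3) * (4/3) ^ n"
      by simp
  qed
qed

lemma optimal_pebbling_number_hypercube_le:
  assumes "attainable n k B" "1 \<le> k"
  shows "real (optimal_pebbling_number (hypercube n)) \<le> B"
proof -
  obtain D where D: "real (pebbling_size (hypercube n) D) \<le> B"
    "\<And>t. length t = n \<Longrightarrow> reach (hypercube n) D k t"
    using assms unfolding attainable_def by blast
  have "pebbling_solvable (hypercube n) D"
    unfolding pebbling_solvable_def
  proof
    fix t assume "t \<in> pverts (hypercube n)"
    then have "reach (hypercube n) D 1 t"
      using D(2) assms(2) by (auto intro: reach_mono)
    then show "\<exists>D'. (pebbling_move (hypercube n))\<^sup>*\<^sup>* D D' \<and> 1 \<le> D' t"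
      by (simp add: reach_def)
  qed
  then show ?thesis
    using optimal_pebbling_number_le D(1) by (meson of_nat_mono order_trans)
qed

section \<open>Lower bound by a weight function\<close>

definition potential :: "nat \<Rightarrow> (bool list \<Rightarrow> nat) \<Rightarrow> bool list \<Rightarrow> real" where
  "potential n D t = (\<Sum>v | length v = n. real (D v) * (1/2) ^ hamming v t)"

text \<open>A move shortens the distance to \<open>t\<close> by at most one, so the arriving pebble
  weighs at most as much as the two that are removed.\<close>

lemma potential_move:
  assumes "pebbling_move (hypercube n) D D'" "length t = n"
  shows "potential n D' t \<le> potential n D t"
proof -
  let ?g = "\<lambda>v. (1/2 :: real) ^ hamming v t" and ?V = "{v :: bool list. length v = n}"
  have fin: "finite ?V"
    using finite_pverts_hypercube[of n] by simp
  obtain u v where uv: "(u, v) \<in> parcs (hypercube n)" "2 \<le> D u" "D' = D(u := D u - 2, v := D v + 1)"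
    using assms(1) unfolding pebbling_move_def by blast
  have len: "length u = n" "length v = n" and h: "hamming u v = 1"
    using uv(1) by (auto simp: parcs_hypercube_iff)
  have "u \<noteq> v" using h by auto
  then have "real (D' x) * ?g x
      = real (D x) * ?g x - (if x = u then 2 * ?g x else 0) + (if x = v then ?g x else 0)" for x
    using uv(2,3) by (auto simp: algebra_simps)
  then have "potential n D' t = potential n D t - 2 * ?g u + ?g v"
    unfolding potential_def using fin len by (simp add: sum.distrib sum_subtractf sum.delta)
  moreover have "?g v \<le> 2 * ?g u"
  proof -
    have "hamming u t \<le> Suc (hamming v t)"
      using hamming_triangle[of u v t] len assms(2) h by simp
    then have "(1/2 :: real) ^ Suc (hamming v t) \<le> ?g u"
      by (intro power_decreasing) auto
    then show ?thesis by simp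
  qed
  ultimately show ?thesis by simp
qed

lemma potential_ge_1:
  assumes "(pebbling_move (hypercube n))\<^sup>*\<^sup>* D D'" "1 \<le> D' t" "length t = n"
  shows "1 \<le> potential n D t"
proof -
  have "real (D' t) * (1/2) ^ hamming t t \<le> potential n D' t"
    unfolding potential_def
    by (rule member_le_sum) (use assms(3) finite_pverts_hypercube[of n] in auto)
  also have "potential n D' t \<le> potential n D t"
    using assms(1)
    by (induction rule: rtranclp_induct) (use potential_move assms(3) order_trans in blast)+
  finally show ?thesis using assms(2) by simp
qed

lemma optimal_pebbling_number_hypercube_ge:
  "(4/3) ^ n \<le> real (optimal_pebbling_number (hypercube n))"
proof -
  let ?V = "{v :: bool list. length v = n}"
  obtain D where D: "pebbling_solvable (hypercube n) D"
    "pebbling_size (hypercube n) D = optimal_pebbling_number (hypercube n)"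
    using optimal_pebbling_number_attained by blast
  have "(2 :: real) ^ n = (\<Sum>t\<in>?V. 1)"
    using card_lists_length_eq[of "UNIV :: bool set" n] by simp
  also have "\<dots> \<le> (\<Sum>t\<in>?V. potential n D t)"
  proof (rule sum_mono)
    fix t assume t: "t \<in> ?V"
    then obtain D' where "(pebbling_move (hypercube n))\<^sup>*\<^sup>* D D'" "1 \<le> D' t"
      using D(1) unfolding pebbling_solvable_def by auto
    with t show "1 \<le> potential n D t"
      by (simp add: potential_ge_1)
  qed
  also have "\<dots> = (\<Sum>v\<in>?V. \<Sum>t\<in>?V. real (D v) * (1/2) ^ hamming v t)"
    unfolding potential_def by (rule sum.swap)
  \<comment> \<open>Summed over all targets, every pebble has the same total weight, whatever its
    vertex.\<close>
  also have "\<dots> = (\<Sum>v\<in>?V. real (D v) * (3/2) ^ n)"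
  proof (intro sum.cong refl)
    fix v assume "v \<in> ?V"
    then show "(\<Sum>t\<in>?V. real (D v) * (1/2) ^ hamming v t) = real (D v) * (3/2) ^ n"
      using hamming_moment_0[of v]
      by (simp add: hamming_commute[of v] flip: sum_distrib_left)
  qed
  also have "\<dots> = real (pebbling_size (hypercube n) D) * (3/2) ^ n"
    by (simp add: pebbling_size_def sum_distrib_right)
  finally have "2 ^ n \<le> real (optimal_pebbling_number (hypercube n)) * (3/2) ^ n"
    using D(2) by simp
  moreover have "(2 :: real) ^ n = (4/3) ^ n * (3/2) ^ n"
    by (simp flip: power_mult_distrib)
  ultimately show ?thesis by simp
qed

theorem theorem1:
  shows "(\<lambda>n. real (optimal_pebbling_number (hypercube n))) \<in> \<Theta>(\<lambda>n. (4 / 3) ^ n)"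
proof (rule bigthetaI)
  \<comment> \<open>Any fixed \<open>c\<close> from 20 on will do; it affects only the constant
    \<open>C\<close>.\<close>
  obtain c :: nat where c: "20 \<le> c" by blast
  define C where "C = exp (5 / (real c - 1)) * 2 ^ (4 * c ^ 3)"
  have "real (optimal_pebbling_number (hypercube n)) \<le> C * (4/3) ^ n" for n
    unfolding C_def
    by (rule optimal_pebbling_number_hypercube_le[OF attainable_power[OF c]]) simp
  then show "(\<lambda>n. real (optimal_pebbling_number (hypercube n))) \<in> O(\<lambda>n. (4 / 3) ^ n)"
    by (intro bigoI[of _ C] always_eventually) simp
  show "(\<lambda>n. real (optimal_pebbling_number (hypercube n))) \<in> \<Omega>(\<lambda>n. (4 / 3) ^ n)"
    by (rule landau_omega.bigI[of 1]) (auto simp: optimal_pebbling_number_hypercube_ge)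
qed

end
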